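(* Let $\mathbf{A}\in\mathbb{C}^{m\times n}$ be a full-rank standardized matrix with $n$ columns and $m>n$ rows, every two of which are linearly independent, and suppose $\mathbf{A}\mathbf{x}=\mathbf{b}$. Let $\mathbf{x}_k$ denote the estimate of the solution $\mathbf{x}$ in the $k$th iteration of the two-subspace Kaczmarz method started from an arbitrary fixed initial estimate $\mathbf{x}_0\in\mathbb{C}^n$. Then, for every $k\ge 0$, $$\mathbb{E}\|\mathbf{x}-\mathbf{x}_k\|_2^2\le\left(\left(1-\frac1R\right)^2-\frac{D}{R}\right)^k\|\mathbf{x}-\mathbf{x}_0\|_2^2,$$ where $$D=\min\left\{\frac{\delta^2(1-\delta)}{1+\delta},\ \frac{\Delta^2(1-\Delta)}{1+\Delta}\right\},$$ $\delta$ and $\Delta$ are the coherence parameters of $\mathbf{A}$, and $R=\|\mathbf{A}\|_F^2\,\|\mathbf{A}^{-1}\|^2$ is the scaled condition number.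
   Context: Notation. $\langle\cdot,\cdot\rangle$ is the standard inner product on $\mathbb{C}^n$, linear in the first argument and conjugate-linear in the second; $\|\cdot\|_2$ is the Euclidean norm; $\|\cdot\|_F$ is the Frobenius norm. The rows of $\mathbf{A}$ are represented by vectors $\mathbf{a}_1,\dots,\mathbf{a}_m\in\mathbb{C}^n$ with $(\mathbf{A}\mathbf{x})_i=\langle\mathbf{x},\mathbf{a}_i\rangle$ for all $\mathbf{x}$, so the system $\mathbf{A}\mathbf{x}=\mathbf{b}$ reads $\langle\mathbf{x},\mathbf{a}_i\rangle=b_i$, $i=1,\dots,m$. $\mathbf{A}$ is standardized if $\|\mathbf{a}_i\|_2=1$ for every $i$. For $\mathbf{A}$ of full (column) rank, $\|\mathbf{A}^{-1}\|=\inf\{M: M\|\mathbf{A}\mathbf{z}\|_2\ge\|\mathbf{z}\|_2\text{ for all }\mathbf{z}\in\mathbb{C}^n\}$. Coherence parameters: $\Delta=\max_{j\ne k}|\langle\mathbf{a}_j,\mathbf{a}_k\rangle|$ and $\delta=\min_{j\ne k}|\langle\mathbf{a}_j,\mathbf{a}_k\rangle|$. Two-subspace Kaczmarz method: at each iteration $k=1,2,\dots$, choose an ordered pair $(r,s)$ of distinct indices in $\{1,\dots,m\}$ uniformly at random from all $m^2-m$ such pairs, independently of all previous iterations, and set $$\mu_k=\langle\mathbf{a}_r,\mathbf{a}_s\rangle,\qquad \mathbf{y}_k=\mathbf{x}_{k-1}+(b_s-\langle\mathbf{x}_{k-1},\mathbf{a}_s\rangle)\mathbf{a}_s,$$ $$\mathbf{v}_k=\frac{\mathbf{a}_r-\mu_k\mathbf{a}_s}{\sqrt{1-|\mu_k|^2}},\qquad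 \beta_k=\frac{b_r-b_s\overline{\mu_k}}{\sqrt{1-|\mu_k|^2}},\qquad \mathbf{x}_k=\mathbf{y}_k+(\beta_k-\langle\mathbf{y}_k,\mathbf{v}_k\rangle)\mathbf{v}_k.$$ Linear independence of each pair of rows gives $|\mu_k|\neq1$, so the divisions are well defined. The expectation is over the random choices of pairs in iterations $1,\dots,k$. *)

theory Defs
  imports "HOL-Probability.Probability"
begin

text \<open>The library's inner product on \<^typ>\<open>complex ^ 'n\<close> is real-valued (the real part of the
  Hermitian one), so the Hermitian product is defined here. The library's \<^const>\<open>norm\<close> on
  \<^typ>\<open>complex ^ 'n\<close> is the Euclidean norm.\<close>

definition hinner :: "complex ^ 'n \<Rightarrow> complex ^ 'n \<Rightarrow> complex" where
  "hinner x y = (\<Sum>j\<in>UNIV. x $ j * cnj (y $ j))"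

text \<open>The vector representing the \<open>i\<close>-th row: conjugated, because \<^const>\<open>hinner\<close> is
  conjugate-linear in its second argument (see \<open>matrix_vector_mult_hinner\<close> below).\<close>

definition row_vec :: "complex ^ 'n ^ 'm \<Rightarrow> 'm \<Rightarrow> complex ^ 'n" where
  "row_vec A i = (\<chi> j. cnj (A $ i $ j))"

lemma matrix_vector_mult_hinner: "(A *v x) $ i = hinner x (row_vec A i)"
  by (simp add: matrix_vector_mult_def hinner_def row_vec_def mult.commute)

definition standardized :: "complex ^ 'n ^ 'm \<Rightarrow> bool" where
  "standardized A \<longleftrightarrow> (\<forall>i. norm (row_vec A i) = 1)"

text \<open>The inequality excludes two equal rows, whose set would be a singleton.\<close>

definition rows_pairwise_independent :: "complex ^ 'n ^ 'm \<Rightarrow> bool" where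
  "rows_pairwise_independent A \<longleftrightarrow>
     (\<forall>i j. i \<noteq> j \<longrightarrow> row i A \<noteq> row j A \<and> vec.independent {row i A, row j A})"

definition frobenius_norm :: "complex ^ 'n ^ 'm \<Rightarrow> real" where
  "frobenius_norm A = sqrt (\<Sum>i\<in>UNIV. \<Sum>j\<in>UNIV. (cmod (A $ i $ j))\<^sup>2)"

definition inverse_norm :: "complex ^ 'n ^ 'm \<Rightarrow> real" where
  "inverse_norm A = Inf {M. \<forall>z. M * norm (A *v z) \<ge> norm z}"

definition scaled_cond :: "complex ^ 'n ^ 'm \<Rightarrow> real" where
  "scaled_cond A = (frobenius_norm A)\<^sup>2 * (inverse_norm A)\<^sup>2"

definition max_coherence :: "complex ^ 'n ^ 'm \<Rightarrow> real" where
  "max_coherence A = Max {cmod (hinner (row_vec A j) (row_vec A k)) | j k. j \<noteq> k}"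

definition min_coherence :: "complex ^ 'n ^ 'm \<Rightarrow> real" where
  "min_coherence A = Min {cmod (hinner (row_vec A j) (row_vec A k)) | j k. j \<noteq> k}"

definition coherence_gain :: "complex ^ 'n ^ 'm \<Rightarrow> real" where
  "coherence_gain A =
     (let \<delta> = min_coherence A; \<Delta> = max_coherence A
      in min (\<delta>\<^sup>2 * (1 - \<delta>) / (1 + \<delta>)) (\<Delta>\<^sup>2 * (1 - \<Delta>) / (1 + \<Delta>)))"

definition two_subspace_step ::
  "complex ^ 'n ^ 'm \<Rightarrow> complex ^ 'm \<Rightarrow> 'm \<times> 'm \<Rightarrow> complex ^ 'n \<Rightarrow> complex ^ 'n" where
  "two_subspace_step A b = (\<lambda>(r, s) x.
     let a = row_vec A;
         \<mu> = hinner (a r) (a s);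
         y = x + (b $ s - hinner x (a s)) *s a s;
         c = complex_of_real (sqrt (1 - (cmod \<mu>)\<^sup>2));
         v = (1 / c) *s (a r - \<mu> *s a s);
         \<beta> = (b $ r - b $ s * cnj \<mu>) / c
     in y + (\<beta> - hinner y v) *s v)"

text \<open>The iterate \<open>x\<^sub>k\<close> for given selections \<open>p 1, p 2, \<dots>\<close>; the value \<open>p 0\<close> is not used.\<close>

primrec two_subspace_iterate ::
  "complex ^ 'n ^ 'm \<Rightarrow> complex ^ 'm \<Rightarrow> complex ^ 'n \<Rightarrow> (nat \<Rightarrow> 'm \<times> 'm) \<Rightarrow> nat \<Rightarrow> complex ^ 'n"
where
  "two_subspace_iterate A b x0 p 0 = x0"
| "two_subspace_iterate A b x0 p (Suc k) =
     two_subspace_step A b (p (Suc k)) (two_subspace_iterate A b x0 p k)"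

definition iid_uniform_pairs :: "'w measure \<Rightarrow> (nat \<Rightarrow> 'w \<Rightarrow> 'm::finite \<times> 'm) \<Rightarrow> bool" where
  "iid_uniform_pairs M P \<longleftrightarrow>
     prob_space.indep_vars M (\<lambda>_. count_space UNIV) P {1..} \<and>
     (\<forall>k\<ge>1. distr M (count_space UNIV) (P k) = measure_pmf (pmf_of_set {(r, s). r \<noteq> s}))"

end

theory Submission
  imports Defs
begin

text \<open>Write \<open>z\<close> for the error before a step, \<open>a\<^sub>i\<close> for the rows, \<open>m\<close> for their number,
  \<open>\<mu> = \<langle>a\<^sub>r, a\<^sub>s\<rangle>\<close>, and \<open>w\<close> for the component of \<open>z\<close> orthogonal to \<open>a\<^sub>s\<close>. A step removes from
  the error its projection onto the plane spanned by \<open>a\<^sub>r\<close> and \<open>a\<^sub>s\<close>: first the part along \<open>a\<^sub>s\<close>,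
  which leaves \<open>w\<close>, and then the part along \<open>v\<close>. Since \<open>w\<close> is orthogonal to \<open>a\<^sub>s\<close>, the new squared
  error is \<open>\<parallel>w\<parallel>\<^sup>2 - |\<langle>w, a\<^sub>r\<rangle>|\<^sup>2 / (1 - |\<mu>|\<^sup>2)\<close> (lemma \<open>norm_two_subspace_step_error\<close>). Because
  \<open>1 / (1 - t) = 1 + t / (1 - t)\<close>, this is

  \<open>(\<parallel>w\<parallel>\<^sup>2 - |\<langle>w, a\<^sub>r\<rangle>|\<^sup>2) - |\<langle>w, a\<^sub>r\<rangle>|\<^sup>2 |\<mu>|\<^sup>2 / (1 - |\<mu>|\<^sup>2)\<close>.

  The bracket is the squared error after two ordinary Kaczmarz steps with the rows \<open>s\<close> and \<open>r\<close>. Its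
  average over all pairs is at most \<open>(1 - 1/R)\<^sup>2 \<parallel>z\<parallel>\<^sup>2\<close> (lemma \<open>sum_two_kaczmarz_steps_le\<close>), since
  full rank gives \<open>(m/R) \<parallel>u\<parallel>\<^sup>2 \<le> \<Sum>\<^sub>i |\<langle>u, a\<^sub>i\<rangle>|\<^sup>2\<close> for every \<open>u\<close>.

  The last term is the gain over ordinary Kaczmarz; its average is at least \<open>(D/R) \<parallel>z\<parallel>\<^sup>2\<close>
  (lemma \<open>sum_coherence_gain_ge\<close>). For a single pair it can vanish, but the pairs \<open>(r, s)\<close> and
  \<open>(s, r)\<close> together contribute at least \<open>f(|\<mu>|) (|\<langle>z, a\<^sub>r\<rangle>|\<^sup>2 + |\<langle>z, a\<^sub>s\<rangle>|\<^sup>2)\<close> with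
  \<open>f(t) = t\<^sup>2 (1 - t) / (1 + t)\<close>. This \<open>f\<close> first increases and then decreases, so on \<open>[\<delta>, \<Delta>]\<close> it is at
  least the smaller of its values at the end points, which is \<open>D\<close>.

  Hence one step contracts the mean squared error by the factor \<open>\<rho> = (1 - 1/R)\<^sup>2 - D/R\<close>, whatever the
  current iterate. The pair chosen next is independent of the current iterate, so the contraction
  can be averaged over the past and iterated.\<close>

section \<open>Hermitian geometry\<close>

lemma hinner_diff_left: "hinner (x - y) z = hinner x z - hinner y z"
  by (simp add: hinner_def sum_subtractf algebra_simps)

lemma hinner_scale_left: "hinner (c *s x) z = c * hinner x z"
  by (simp add: hinner_def sum_distrib_left algebra_simps)

lemma cnj_hinner: "cnj (hinner x y) = hinner y x"
  by (simp add: hinner_def algebra_simps)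

lemma hinner_diff_right: "hinner x (y - z) = hinner x y - hinner x z"
  by (simp add: hinner_def sum_subtractf algebra_simps)

lemma hinner_scale_right: "hinner x (c *s z) = cnj c * hinner x z"
  by (simp add: hinner_def sum_distrib_left algebra_simps)

lemma cmod_hinner_commute: "cmod (hinner x y) = cmod (hinner y x)"
  by (metis cnj_hinner complex_mod_cnj)

lemma norm_cvec_power2: "(norm (x :: complex ^ 'n))\<^sup>2 = (\<Sum>j\<in>UNIV. (cmod (x $ j))\<^sup>2)"
  by (simp add: norm_vec_def L2_set_def sum_nonneg)

lemma hinner_self: "hinner x x = complex_of_real ((norm x)\<^sup>2)"
  by (simp only: hinner_def norm_cvec_power2 complex_norm_square of_real_sum)

text \<open>Pythagoras' theorem; for an error \<open>w\<close> and a row \<open>u\<close> it is the exact effect of an ordinary Kaczmarz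
  step.\<close>

lemma norm_diff_projection:
  assumes "norm u = 1"
  shows "(norm (w - hinner w u *s u))\<^sup>2 = (norm w)\<^sup>2 - (cmod (hinner w u))\<^sup>2"
proof -
  have "complex_of_real ((norm (w - hinner w u *s u))\<^sup>2) =
      hinner (w - hinner w u *s u) (w - hinner w u *s u)"
    by (simp add: hinner_self)
  also have "\<dots> = hinner w w - hinner w u * cnj (hinner w u)"
    using assms
    by (simp add: hinner_diff_left hinner_diff_right hinner_scale_left hinner_scale_right
        cnj_hinner hinner_self[of u] algebra_simps)
  also have "\<dots> = complex_of_real ((norm w)\<^sup>2 - (cmod (hinner w u))\<^sup>2)"
    by (simp only: hinner_self complex_norm_square of_real_diff)
  finally show ?thesis
    using of_real_eq_iff by blast
qed

lemma cmod_hinner_unit_le: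
  assumes "norm u = 1"
  shows "(cmod (hinner w u))\<^sup>2 \<le> (norm w)\<^sup>2"
  using norm_diff_projection[OF assms, of w] zero_le_power2[of "norm (w - hinner w u *s u)"]
  by linarith

text \<open>In the equality case of the Cauchy--Schwarz inequality \<open>a\<^sub>i - \<langle>a\<^sub>i, a\<^sub>j\<rangle> a\<^sub>j\<close> has norm
  zero, so the two rows are proportional.\<close>

lemma cmod_hinner_rows_less_one:
  fixes A :: "complex ^ 'n ^ 'm"
  assumes "standardized A" and "rows_pairwise_independent A" and "i \<noteq> j"
  shows "cmod (hinner (row_vec A i) (row_vec A j)) < 1"
proof -
  \<comment> \<open>Kept folded: \<open>\<mu>\<close> mentions \<open>A\<close>, so equations for the entries of \<open>A\<close> would loop as rewrite rules.\<close>
  define \<mu> where "\<mu> = hinner (row_vec A i) (row_vec A j)"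
  have unit: "norm (row_vec A i) = 1" "norm (row_vec A j) = 1"
    using assms(1) by (auto simp: standardized_def)
  have "row_vec A i - \<mu> *s row_vec A j \<noteq> 0"
  proof
    assume "row_vec A i - \<mu> *s row_vec A j = 0"
    then have "row_vec A i = \<mu> *s row_vec A j"
      by simp
    then have "cnj (row_vec A i $ l) = cnj ((\<mu> *s row_vec A j) $ l)" for l
      by simp
    then have "row i A = cnj \<mu> *s row j A"
      by (simp add: vec_eq_iff row_vec_def row_def)
    then have "row i A \<in> vec.span {row j A}"
      by (simp add: vec.span_base vec.span_scale)
    moreover have "{row i A, row j A} - {row i A} = {row j A}"
      using assms(2,3) by (auto simp: rows_pairwise_independent_def)
    ultimately have "row i A \<in> vec.span ({row i A, row j A} - {row i A})"
      by simp
    then have "vec.dependent {row i A, row j A}"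
      unfolding vec.dependent_def by blast
    then show False
      using assms(2,3) by (auto simp: rows_pairwise_independent_def)
  qed
  then have "0 < (norm (row_vec A i - \<mu> *s row_vec A j))\<^sup>2"
    by simp
  then have "(cmod \<mu>)\<^sup>2 < 1"
    using norm_diff_projection[OF unit(2), of "row_vec A i"] unit(1) by (simp add: \<mu>_def)
  then have "cmod \<mu> < 1"
    using power2_less_imp_less[of "cmod \<mu>" 1] by simp
  then show ?thesis
    by (simp add: \<mu>_def)
qed

section \<open>The error after one step\<close>

text \<open>Both halves of a step subtract from the error its projection onto a unit vector, first \<open>a\<^sub>s\<close> and then
  \<open>v\<close>, because \<open>b\<^sub>s = \<langle>x, a\<^sub>s\<rangle>\<close> and \<open>\<beta> = \<langle>x, v\<rangle>\<close> for the solution \<open>x\<close>. After the first half the error \<open>w\<close> is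
  orthogonal to \<open>a\<^sub>s\<close>, so \<open>\<langle>w, v\<rangle>\<close> is \<open>\<langle>w, a\<^sub>r\<rangle>\<close> divided by the normalising constant of \<open>v\<close>.\<close>

lemma norm_two_subspace_step_error:
  fixes A :: "complex ^ 'n ^ 'm" and y :: "complex ^ 'n"
  assumes std: "standardized A" and ind: "rows_pairwise_independent A"
    and sol: "A *v x = b" and rs: "r \<noteq> s"
  defines "\<mu> \<equiv> hinner (row_vec A r) (row_vec A s)"
    and "w \<equiv> (x - y) - hinner (x - y) (row_vec A s) *s row_vec A s"
  shows "(norm (x - two_subspace_step A b (r, s) y))\<^sup>2 =
    (norm w)\<^sup>2 - (cmod (hinner w (row_vec A r)))\<^sup>2 / (1 - (cmod \<mu>)\<^sup>2)"
proof -
  define c where "c = complex_of_real (sqrt (1 - (cmod \<mu>)\<^sup>2))"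
  define v where "v = (1 / c) *s (row_vec A r - \<mu> *s row_vec A s)"
  have unit: "norm (row_vec A i) = 1" for i
    using std by (auto simp: standardized_def)
  have pos: "0 < 1 - (cmod \<mu>)\<^sup>2"
    using cmod_hinner_rows_less_one[OF std ind rs]
    by (simp add: \<mu>_def power_less_one_iff)
  have c_sq: "(cmod c)\<^sup>2 = 1 - (cmod \<mu>)\<^sup>2"
    using pos by (simp add: c_def norm_of_real)
  have c0: "c \<noteq> 0" and cnj_c: "cnj c = c"
    using pos by (auto simp: c_def)
  have b: "b $ i = hinner x (row_vec A i)" for i
    using sol matrix_vector_mult_hinner by metis
  \<comment> \<open>The subtracted multiple of \<open>a\<^sub>s\<close> in \<open>v\<close> is invisible to \<open>w\<close>.\<close>
  have "hinner w (row_vec A s) = 0"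
    using unit by (simp add: w_def hinner_diff_left hinner_scale_left hinner_self)
  then have wv: "hinner w v = hinner w (row_vec A r) / c"
    by (simp add: v_def hinner_diff_right hinner_scale_right cnj_c)
  have "complex_of_real ((norm (row_vec A r - \<mu> *s row_vec A s))\<^sup>2) =
      complex_of_real (1 - (cmod \<mu>)\<^sup>2)"
    using norm_diff_projection[OF unit, of "row_vec A r" s] unit by (simp add: \<mu>_def)
  moreover have "c * c = complex_of_real (1 - (cmod \<mu>)\<^sup>2)"
    using pos by (simp add: c_def flip: of_real_mult)
  ultimately have "hinner (row_vec A r - \<mu> *s row_vec A s) (row_vec A r - \<mu> *s row_vec A s) = c * c"
    by (simp only: hinner_self)
  then have "hinner v v = 1"
    unfolding v_def hinner_scale_left hinner_scale_right using c0 by (simp add: cnj_c)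
  then have "(norm v)\<^sup>2 = 1"
    unfolding hinner_self of_real_eq_1_iff .
  then have v1: "norm v = 1"
    using norm_ge_zero[of v] by (simp add: power2_eq_1_iff)
  have \<beta>: "(b $ r - b $ s * cnj \<mu>) / c = hinner x v"
    by (simp add: v_def b hinner_diff_right hinner_scale_right cnj_c algebra_simps diff_divide_distrib)
  define y' where "y' = y + (b $ s - hinner y (row_vec A s)) *s row_vec A s"
  have "two_subspace_step A b (r, s) y = y' + (hinner x v - hinner y' v) *s v"
    unfolding two_subspace_step_def Let_def prod.case \<mu>_def[symmetric] c_def[symmetric]
      v_def[symmetric] y'_def[symmetric] \<beta> by (rule refl)
  moreover have "w = x - y'"
    by (simp add: w_def y'_def b hinner_diff_left)
  ultimately have "x - two_subspace_step A b (r, s) y = w - hinner w v *s v"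
    by (simp add: hinner_diff_left)
  then have "(norm (x - two_subspace_step A b (r, s) y))\<^sup>2 = (norm w)\<^sup>2 - (cmod (hinner w v))\<^sup>2"
    using norm_diff_projection[OF v1] by simp
  then show ?thesis
    by (simp add: wv norm_divide power_divide c_sq)
qed

section \<open>The coherence gain\<close>

text \<open>The function \<open>f\<close> increases up to the positive root of \<open>1 - t - t\<^sup>2\<close> and decreases afterwards.
  For nonnegative arguments \<open>f v - f u\<close> has the sign of \<open>(v - u) q u v\<close> for a polynomial \<open>q\<close>, and the sign
  of \<open>1 - t - t\<^sup>2\<close> decides which end point to compare \<open>t\<close> with.\<close>

lemma coherence_function_ge_min:
  fixes a t b :: real
  assumes "0 \<le> a" "a \<le> t" "t \<le> b"
  defines "f \<equiv> \<lambda>t. t\<^sup>2 * (1 - t) / (1 + t)"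
  shows "min (f a) (f b) \<le> f t"
proof -
  define q where "q = (\<lambda>u v :: real. (u + v) * (1 - u * v) - u\<^sup>2 - v\<^sup>2)"
  have diff: "f v - f u = (v - u) * q u v / ((1 + u) * (1 + v))" if "0 \<le> u" "0 \<le> v" for u v
    using that by (simp add: f_def q_def divide_simps) (simp add: algebra_simps power2_eq_square)
  show ?thesis
  proof (cases "0 \<le> 1 - t - t\<^sup>2")
    case True
    \<comment> \<open>\<open>t\<close> lies on the increasing branch: compare with \<open>a\<close>.\<close>
    have "t * (1 - t - t\<^sup>2) + a * (1 - t - t\<^sup>2) + (t - a) * t\<^sup>2 + a * (t - a) * (1 + t) = q a t"
      by (simp add: q_def algebra_simps power2_eq_square)
    moreover have "0 \<le> t * (1 - t - t\<^sup>2)" "0 \<le> a * (1 - t - t\<^sup>2)" "0 \<le> (t - a) * t\<^sup>2"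
      "0 \<le> a * (t - a) * (1 + t)"
      using True assms by auto
    ultimately have "0 \<le> q a t"
      by linarith
    then have "0 \<le> f t - f a"
      using assms by (subst diff) auto
    then show ?thesis
      by linarith
  next
    case False
    \<comment> \<open>\<open>t\<close> lies on the decreasing branch: compare with \<open>b\<close>.\<close>
    have "t * (1 - t - t\<^sup>2) + b * (1 - t - t\<^sup>2) - (b - t) * t\<^sup>2 - b * (b - t) * (1 + t) = q t b"
      by (simp add: q_def algebra_simps power2_eq_square)
    moreover have "t * (1 - t - t\<^sup>2) \<le> 0" "b * (1 - t - t\<^sup>2) \<le> 0" "0 \<le> (b - t) * t\<^sup>2"
      "0 \<le> b * (b - t) * (1 + t)"
      using False assms by (auto simp: mult_nonneg_nonpos)
    ultimately have "q t b \<le> 0"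
      by linarith
    then have "f b - f t \<le> 0"
      using assms by (subst diff) (auto intro!: divide_nonpos_nonneg mult_nonneg_nonpos)
    then show ?thesis
      by linarith
  qed
qed

lemma finite_coherences:
  fixes A :: "complex ^ 'n ^ 'm"
  shows "finite {cmod (hinner (row_vec A j) (row_vec A k)) | j k. j \<noteq> k}"
  by (rule finite_subset[of _ "range (\<lambda>(j, k). cmod (hinner (row_vec A j) (row_vec A k)))"]) auto

lemma coherence_gain_le:
  fixes A :: "complex ^ 'n ^ 'm"
  assumes "j \<noteq> k"
  defines "t \<equiv> cmod (hinner (row_vec A j) (row_vec A k))"
  shows "coherence_gain A \<le> t\<^sup>2 * (1 - t) / (1 + t)"
proof -
  let ?C = "{cmod (hinner (row_vec A j) (row_vec A k)) | j k. j \<noteq> k}"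
  have t: "t \<in> ?C"
    using assms by blast
  then have "?C \<noteq> {}"
    by blast
  then have "min_coherence A \<in> ?C"
    unfolding min_coherence_def by (rule Min_in[OF finite_coherences])
  then have "0 \<le> min_coherence A"
    by auto
  moreover have "min_coherence A \<le> t"
    unfolding min_coherence_def by (rule Min_le[OF finite_coherences t])
  moreover have "t \<le> max_coherence A"
    unfolding max_coherence_def by (rule Max_ge[OF finite_coherences t])
  ultimately show ?thesis
    unfolding coherence_gain_def Let_def by (rule coherence_function_ge_min)
qed

lemma coherence_gain_nonneg:
  fixes A :: "complex ^ 'n ^ 'm"
  assumes "standardized A" and "rows_pairwise_independent A" and "1 < CARD('m)"
  shows "0 \<le> coherence_gain A"
proof -
  let ?C = "{cmod (hinner (row_vec A j) (row_vec A k)) | j k. j \<noteq> k}"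
  have "\<not> CARD('m) \<le> Suc 0"
    using assms(3) by simp
  then obtain j k :: 'm where "j \<noteq> k"
    using card_le_Suc0_iff_eq[of "UNIV :: 'm set"] by auto
  then have "?C \<noteq> {}"
    by blast
  then have "min_coherence A \<in> ?C" "max_coherence A \<in> ?C"
    unfolding min_coherence_def max_coherence_def
    using Min_in[OF finite_coherences] Max_in[OF finite_coherences] by blast+
  moreover have "0 \<le> t \<and> t \<le> 1" if "t \<in> ?C" for t
    using that cmod_hinner_rows_less_one[OF assms(1,2)] by (force intro: less_imp_le)
  ultimately have "0 \<le> min_coherence A" "min_coherence A \<le> 1"
    "0 \<le> max_coherence A" "max_coherence A \<le> 1"
    by blast+
  then show ?thesis
    by (simp add: coherence_gain_def Let_def)
qed

text \<open>With \<open>p = \<langle>z, a\<^sub>r\<rangle>\<close>, \<open>q = \<langle>z, a\<^sub>s\<rangle>\<close> and \<open>m = \<mu>\<close>, the right-hand side collects the residuals of the pairs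
  \<open>(r, s)\<close> and \<open>(s, r)\<close>. Either of them alone may be zero. The reverse triangle inequality reduces the
  claim to moduli, where the two sides differ by \<open>2 |m| (|p| - |q|)\<^sup>2\<close>.\<close>

lemma symmetrised_residual_ge:
  fixes p q m :: complex
  shows "(1 - cmod m)\<^sup>2 * ((cmod p)\<^sup>2 + (cmod q)\<^sup>2) \<le>
    (cmod (p - q * cnj m))\<^sup>2 + (cmod (q - p * m))\<^sup>2"
proof -
  let ?P = "cmod p" and ?Q = "cmod q" and ?t = "cmod m"
  have rev: "(cmod u - cmod v)\<^sup>2 \<le> (cmod (u - v))\<^sup>2" for u v :: complex
    using norm_triangle_ineq3[of u v] by (metis abs_le_square_iff abs_norm_cancel)
  have "(1 - ?t)\<^sup>2 * (?P\<^sup>2 + ?Q\<^sup>2) + 2 * ?t * (?P - ?Q)\<^sup>2 = (?P - ?Q * ?t)\<^sup>2 + (?Q - ?P * ?t)\<^sup>2"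
    by (simp add: algebra_simps power2_eq_square)
  moreover have "0 \<le> 2 * ?t * (?P - ?Q)\<^sup>2"
    by simp
  moreover have "(?P - ?Q * ?t)\<^sup>2 \<le> (cmod (p - q * cnj m))\<^sup>2" "(?Q - ?P * ?t)\<^sup>2 \<le> (cmod (q - p * m))\<^sup>2"
    using rev[of p "q * cnj m"] rev[of q "p * m"] by (simp_all add: norm_mult)
  ultimately show ?thesis
    by linarith
qed

section \<open>The scaled condition number\<close>

lemma inj_matrix_vector_mult_full_column_rank:
  fixes A :: "'a :: field ^ 'n ^ 'm"
  assumes "rank A = CARD('n)"
  shows "inj ((*v) A)"
proof -
  have "vec.span (rows A) = UNIV"
    using assms
    by (simp add: row_rank_def_gen card_cart_basis vec.dimension_def flip: vec.dim_eq_full)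
  then show ?thesis
    using matrix_left_invertible_span_rows_gen matrix_left_invertible_injective by blast
qed

text \<open>The infimum defining \<^const>\<open>inverse_norm\<close> is attained. Injectivity makes the set of admissible
  constants nonempty, without which its infimum would carry no information.\<close>

lemma norm_le_inverse_norm:
  fixes A :: "complex ^ 'n ^ 'm"
  assumes "rank A = CARD('n)"
  shows "norm z \<le> inverse_norm A * norm (A *v z)"
proof -
  let ?S = "{M. \<forall>z. norm z \<le> M * norm (A *v z)}"
  have inj: "inj ((*v) A)"
    by (rule inj_matrix_vector_mult_full_column_rank[OF assms])
  then obtain B where B: "0 < B" "\<And>z. B * norm z \<le> norm (A *v z)"
    using linear_inj_bounded_below_pos[of "(*v) A"] by auto
  then have "1 / B \<in> ?S"
    by (simp add: field_simps)
  then have ne: "?S \<noteq> {}"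
    by blast
  show ?thesis
  proof (cases "z = 0")
    case False
    then have "A *v z \<noteq> 0"
      using inj by (metis injD matrix_vector_mult_0_right)
    then have pos: "0 < norm (A *v z)"
      by simp
    have "norm z / norm (A *v z) \<le> inverse_norm A"
      unfolding inverse_norm_def
      using pos by (intro cInf_greatest[OF ne]) (simp add: field_simps)
    then show ?thesis
      using pos by (simp add: field_simps)
  qed simp
qed

lemma frobenius_norm_power2_standardized:
  fixes A :: "complex ^ 'n ^ 'm"
  assumes "standardized A"
  shows "(frobenius_norm A)\<^sup>2 = CARD('m)"
proof -
  have "(\<Sum>j\<in>UNIV. (cmod (A $ i $ j))\<^sup>2) = (norm (row_vec A i))\<^sup>2" for i
    by (simp add: norm_cvec_power2 row_vec_def)
  then show ?thesis
    using assms by (simp add: frobenius_norm_def standardized_def)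
qed

lemma norm_matrix_vector_mult_power2:
  "(norm (A *v z))\<^sup>2 = (\<Sum>i\<in>UNIV. (cmod (hinner z (row_vec A i)))\<^sup>2)"
  by (simp add: norm_cvec_power2 matrix_vector_mult_hinner)

text \<open>Every unit row satisfies \<open>|\<langle>z, a\<^sub>i\<rangle>| \<le> \<parallel>z\<parallel>\<close>, so \<open>\<parallel>A z\<parallel>\<^sup>2 \<le> m \<parallel>z\<parallel>\<^sup>2\<close> and the inverse cannot be
  small. This makes \<open>1 - 1/R\<close> nonnegative.\<close>

lemma scaled_cond_ge_one:
  fixes A :: "complex ^ 'n ^ 'm"
  assumes "standardized A" and "rank A = CARD('n)"
  shows "1 \<le> scaled_cond A"
proof -
  obtain z :: "complex ^ 'n" where "norm z = 1"
    using vector_choose_size[of 1] by auto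
  then have "1 \<le> (inverse_norm A * norm (A *v z))\<^sup>2"
    using norm_le_inverse_norm[OF assms(2), of z] by (simp add: one_le_power)
  also have "\<dots> = (inverse_norm A)\<^sup>2 * (\<Sum>i\<in>UNIV. (cmod (hinner z (row_vec A i)))\<^sup>2)"
    by (simp add: power_mult_distrib norm_matrix_vector_mult_power2)
  also have "\<dots> \<le> (inverse_norm A)\<^sup>2 * (\<Sum>i\<in>(UNIV :: 'm set). 1)"
    using assms(1) \<open>norm z = 1\<close> cmod_hinner_unit_le[of _ z]
    by (intro mult_left_mono sum_mono) (auto simp: standardized_def)
  also have "\<dots> = scaled_cond A"
    by (simp add: scaled_cond_def frobenius_norm_power2_standardized[OF assms(1)])
  finally show ?thesis .
qed

text \<open>The estimate through which the condition number enters: a uniformly random row captures on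
  average at least the fraction \<open>1/R\<close> of the squared norm of any vector.\<close>

lemma sum_hinner_rows_ge:
  fixes A :: "complex ^ 'n ^ 'm"
  assumes "standardized A" and "rank A = CARD('n)"
  shows "CARD('m) / scaled_cond A * (norm z)\<^sup>2 \<le> (\<Sum>i\<in>UNIV. (cmod (hinner z (row_vec A i)))\<^sup>2)"
proof -
  have R: "1 \<le> scaled_cond A"
    by (rule scaled_cond_ge_one[OF assms])
  have "(norm z)\<^sup>2 \<le> (inverse_norm A * norm (A *v z))\<^sup>2"
    by (rule power_mono[OF norm_le_inverse_norm[OF assms(2)] norm_ge_zero])
  then have "CARD('m) * (norm z)\<^sup>2 \<le> CARD('m) * (inverse_norm A * norm (A *v z))\<^sup>2"
    by (rule mult_left_mono) simp
  also have "\<dots> = scaled_cond A * (norm (A *v z))\<^sup>2"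
    by (simp add: scaled_cond_def frobenius_norm_power2_standardized[OF assms(1)] power_mult_distrib)
  finally show ?thesis
    using R by (simp add: norm_matrix_vector_mult_power2 field_simps)
qed

section \<open>The averaged contraction\<close>

lemma sum_distinct_pairs:
  fixes g :: "'m :: finite \<Rightarrow> 'm \<Rightarrow> 'a :: comm_ring_1"
  shows "(\<Sum>(r, s)\<in>{(r, s). r \<noteq> s}. g r s) = (\<Sum>s\<in>UNIV. (\<Sum>r\<in>UNIV. g r s) - g s s)"
proof -
  have "(\<Sum>(r, s)\<in>{(r, s). r \<noteq> s}. g r s) = (\<Sum>(s, r)\<in>(SIGMA s:UNIV. UNIV - {s}). g r s)"
    by (rule sum.reindex_bij_witness[of _ prod.swap prod.swap]) auto
  also have "\<dots> = (\<Sum>s\<in>UNIV. \<Sum>r\<in>UNIV - {s}. g r s)"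
    by (simp add: sum.Sigma)
  also have "\<dots> = (\<Sum>s\<in>UNIV. (\<Sum>r\<in>UNIV. g r s) - g s s)"
    by (simp add: sum_diff1)
  finally show ?thesis .
qed

lemma sum_distinct_pairs_swap:
  "(\<Sum>(r, s)\<in>{(r, s). r \<noteq> s}. g r s) = (\<Sum>(r, s)\<in>{(r, s). r \<noteq> s}. g s r)"
  by (rule sum.reindex_bij_witness[of _ prod.swap prod.swap]) auto

lemma card_distinct_pairs:
  "real (card {(r, s :: 'm :: finite). r \<noteq> s}) = CARD('m) * (real CARD('m) - 1)"
  using sum_distinct_pairs[of "\<lambda>_ _ :: 'm. 1 :: real"]
  by (simp add: case_prod_unfold algebra_simps)

text \<open>Two ordinary Kaczmarz steps contract by \<open>1 - 1/R\<close> each. Forbidding \<open>r = s\<close> in the second step does no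
  harm: \<open>y z s\<close> is orthogonal to \<open>a\<^sub>s\<close>, so the missing term is zero, while the average is taken over \<open>m - 1\<close>
  instead of \<open>m\<close> rows.\<close>

lemma sum_two_kaczmarz_steps_le:
  fixes A :: "complex ^ 'n ^ 'm"
  assumes std: "standardized A" and full: "rank A = CARD('n)" and m: "1 < CARD('m)"
  defines "R \<equiv> scaled_cond A"
    and "y \<equiv> \<lambda>z s. z - hinner z (row_vec A s) *s row_vec A s"
  shows "(\<Sum>(r, s)\<in>{(r, s). r \<noteq> s}. (norm (y z s))\<^sup>2 - (cmod (hinner (y z s) (row_vec A r)))\<^sup>2) \<le>
    CARD('m) * (real CARD('m) - 1) * (1 - 1 / R)\<^sup>2 * (norm z)\<^sup>2"
proof -
  let ?m = "real CARD('m)"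
  have R: "1 \<le> R" unfolding R_def by (rule scaled_cond_ge_one[OF std full])
  have unit: "norm (row_vec A i) = 1" for i
    using std by (auto simp: standardized_def)
  have orth: "hinner (y z s) (row_vec A s) = 0" for s
    using unit by (simp add: y_def hinner_diff_left hinner_scale_left hinner_self)
  have "(\<Sum>(r, s)\<in>{(r, s). r \<noteq> s}. (norm (y z s))\<^sup>2 - (cmod (hinner (y z s) (row_vec A r)))\<^sup>2) =
      (\<Sum>s\<in>UNIV. (?m - 1) * (norm (y z s))\<^sup>2 - (\<Sum>r\<in>UNIV. (cmod (hinner (y z s) (row_vec A r)))\<^sup>2))"
    by (simp add: sum_distinct_pairs orth sum_subtractf algebra_simps)
  also have "\<dots> \<le> (\<Sum>s\<in>UNIV. (?m - 1) * (1 - 1 / R) * (norm (y z s))\<^sup>2)"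
  proof (rule sum_mono)
    fix s
    have "?m / R * (norm (y z s))\<^sup>2 \<le> (\<Sum>r\<in>UNIV. (cmod (hinner (y z s) (row_vec A r)))\<^sup>2)"
      unfolding R_def by (rule sum_hinner_rows_ge[OF std full])
    moreover have "(?m - 1) / R * (norm (y z s))\<^sup>2 \<le> ?m / R * (norm (y z s))\<^sup>2"
      using R by (intro mult_right_mono divide_right_mono) auto
    ultimately show "(?m - 1) * (norm (y z s))\<^sup>2 - (\<Sum>r\<in>UNIV. (cmod (hinner (y z s) (row_vec A r)))\<^sup>2)
        \<le> (?m - 1) * (1 - 1 / R) * (norm (y z s))\<^sup>2"
      by (simp add: algebra_simps diff_divide_distrib)
  qed
  also have "\<dots> = (?m - 1) * (1 - 1 / R) * (?m * (norm z)\<^sup>2 - (\<Sum>s\<in>UNIV. (cmod (hinner z (row_vec A s)))\<^sup>2))"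
    using unit by (simp add: y_def norm_diff_projection sum_subtractf flip: sum_distrib_left)
  also have "\<dots> \<le> (?m - 1) * (1 - 1 / R) * (?m * (norm z)\<^sup>2 - ?m / R * (norm z)\<^sup>2)"
    using sum_hinner_rows_ge[OF std full, of z] R m
    by (intro mult_left_mono) (auto simp: R_def)
  also have "\<dots> = ?m * (?m - 1) * (1 - 1 / R)\<^sup>2 * (norm z)\<^sup>2"
    using R by (simp add: power2_eq_square field_simps)
  finally show ?thesis .
qed

text \<open>The extra decrease compared with two ordinary Kaczmarz steps. Twice the sum is the sum of the
  symmetrised terms for \<open>(r, s)\<close> and \<open>(s, r)\<close>; for these the factor \<open>(1 - |\<mu>|)\<^sup>2\<close> of the residual bound
  combines with \<open>|\<mu>|\<^sup>2 / (1 - |\<mu>|\<^sup>2)\<close> to \<open>f(|\<mu>|)\<close>, which is at least the coherence gain.\<close>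

lemma sum_coherence_gain_ge:
  fixes A :: "complex ^ 'n ^ 'm"
  assumes std: "standardized A" and ind: "rows_pairwise_independent A"
    and full: "rank A = CARD('n)" and m: "1 < CARD('m)"
  defines "R \<equiv> scaled_cond A"
    and "y \<equiv> \<lambda>z s. z - hinner z (row_vec A s) *s row_vec A s"
    and "t \<equiv> \<lambda>r s. cmod (hinner (row_vec A r) (row_vec A s))"
  shows "CARD('m) * (real CARD('m) - 1) * (coherence_gain A / R) * (norm z)\<^sup>2 \<le>
    (\<Sum>(r, s)\<in>{(r, s). r \<noteq> s}.
      (cmod (hinner (y z s) (row_vec A r)))\<^sup>2 * ((t r s)\<^sup>2 / (1 - (t r s)\<^sup>2)))"
proof -
  let ?m = "real CARD('m)"
  let ?D = "coherence_gain A"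
  let ?\<alpha> = "\<lambda>i. hinner z (row_vec A i)"
  define g where "g = (\<lambda>r s. (cmod (hinner (y z s) (row_vec A r)))\<^sup>2 * ((t r s)\<^sup>2 / (1 - (t r s)\<^sup>2)))"
  have D: "0 \<le> ?D"
    by (rule coherence_gain_nonneg[OF std ind m])
  have pair: "?D * ((cmod (?\<alpha> r))\<^sup>2 + (cmod (?\<alpha> s))\<^sup>2) \<le> g r s + g s r" if "r \<noteq> s" for r s
  proof -
    let ?\<mu> = "hinner (row_vec A r) (row_vec A s)"
    let ?t = "cmod ?\<mu>"
    let ?S = "(cmod (?\<alpha> r))\<^sup>2 + (cmod (?\<alpha> s))\<^sup>2"
    have t1: "?t < 1"
      by (rule cmod_hinner_rows_less_one[OF std ind that])
    have t_swap: "t s r = ?t" "t r s = ?t"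
      by (simp_all add: t_def cmod_hinner_commute)
    have yr: "hinner (y z s) (row_vec A r) = ?\<alpha> r - ?\<alpha> s * cnj ?\<mu>"
      by (simp add: y_def hinner_diff_left hinner_scale_left cnj_hinner)
    have ys: "hinner (y z r) (row_vec A s) = ?\<alpha> s - ?\<alpha> r * ?\<mu>"
      by (simp add: y_def hinner_diff_left hinner_scale_left)
    have split: "1 - ?t\<^sup>2 = (1 - ?t) * (1 + ?t)"
      by (simp add: algebra_simps power2_eq_square)
    have "?D * ?S \<le> ?t\<^sup>2 * (1 - ?t) / (1 + ?t) * ?S"
      by (intro mult_right_mono coherence_gain_le[OF that]) simp
    also have "\<dots> = (1 - ?t)\<^sup>2 * ?S * (?t\<^sup>2 / (1 - ?t\<^sup>2))"
      using t1 unfolding split by (simp add: power2_eq_square add_eq_0_iff)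
    also have "\<dots> \<le> ((cmod (?\<alpha> r - ?\<alpha> s * cnj ?\<mu>))\<^sup>2 + (cmod (?\<alpha> s - ?\<alpha> r * ?\<mu>))\<^sup>2) * (?t\<^sup>2 / (1 - ?t\<^sup>2))"
      using t1 by (intro mult_right_mono symmetrised_residual_ge divide_nonneg_nonneg)
        (auto simp: power_le_one)
    also have "\<dots> = g r s + g s r"
      by (simp add: g_def t_swap yr ys algebra_simps)
    finally show ?thesis .
  qed
  have R: "1 \<le> R"
    unfolding R_def by (rule scaled_cond_ge_one[OF std full])
  have "2 * (?m * (?m - 1) * (?D / R) * (norm z)\<^sup>2) = 2 * (?D * (?m - 1)) * (?m / R * (norm z)\<^sup>2)"
    by simp
  also have "\<dots> \<le> 2 * (?D * (?m - 1)) * (\<Sum>i\<in>UNIV. (cmod (?\<alpha> i))\<^sup>2)"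
    using D m sum_hinner_rows_ge[OF std full, of z]
    by (intro mult_left_mono) (auto simp: R_def)
  also have "\<dots> = (\<Sum>(r, s)\<in>{(r, s). r \<noteq> s}. ?D * ((cmod (?\<alpha> r))\<^sup>2 + (cmod (?\<alpha> s))\<^sup>2))"
    by (simp add: sum_distinct_pairs sum.distrib sum_subtractf algebra_simps flip: sum_distrib_left)
  also have "\<dots> \<le> (\<Sum>(r, s)\<in>{(r, s). r \<noteq> s}. g r s + g s r)"
    by (rule sum_mono) (use pair in auto)
  also have "\<dots> = (\<Sum>(r, s)\<in>{(r, s). r \<noteq> s}. g r s) + (\<Sum>(r, s)\<in>{(r, s). r \<noteq> s}. g s r)"
    by (simp add: case_prod_unfold sum.distrib)
  also have "\<dots> = 2 * (\<Sum>(r, s)\<in>{(r, s). r \<noteq> s}. g r s)"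
    using sum_distinct_pairs_swap[of g] by simp
  finally show ?thesis
    by (simp add: g_def)
qed

lemma average_two_subspace_step_error_le:
  fixes A :: "complex ^ 'n ^ 'm"
  assumes std: "standardized A" and ind: "rows_pairwise_independent A"
    and full: "rank A = CARD('n)" and m: "1 < CARD('m)" and sol: "A *v x = b"
  shows "(\<Sum>p\<in>{(r, s). r \<noteq> s}. (norm (x - two_subspace_step A b p y))\<^sup>2) \<le>
    card {(r, s :: 'm). r \<noteq> s} *
    (((1 - 1 / scaled_cond A)\<^sup>2 - coherence_gain A / scaled_cond A) * (norm (x - y))\<^sup>2)"
proof -
  let ?S = "{(r, s :: 'm). r \<noteq> s}"
  define z where "z = x - y"
  define w where "w = (\<lambda>s. z - hinner z (row_vec A s) *s row_vec A s)"
  let ?h = "\<lambda>r s. (cmod (hinner (w s) (row_vec A r)))\<^sup>2"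
  let ?t = "\<lambda>r s. cmod (hinner (row_vec A r) (row_vec A s))"
  have step: "(norm (x - two_subspace_step A b (r, s) y))\<^sup>2 =
      (norm (w s))\<^sup>2 - ?h r s - ?h r s * ((?t r s)\<^sup>2 / (1 - (?t r s)\<^sup>2))" if "r \<noteq> s" for r s
  proof -
    have "(?t r s)\<^sup>2 < 1"
      using cmod_hinner_rows_less_one[OF std ind that] by (simp add: power_less_one_iff)
    then have "?h r s / (1 - (?t r s)\<^sup>2) = ?h r s + ?h r s * ((?t r s)\<^sup>2 / (1 - (?t r s)\<^sup>2))"
      by (simp add: divide_simps) (simp add: algebra_simps)
    then show ?thesis
      using norm_two_subspace_step_error[OF std ind sol that, of y] by (simp add: w_def z_def)
  qed
  have "(\<Sum>p\<in>?S. (norm (x - two_subspace_step A b p y))\<^sup>2) =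
      (\<Sum>(r, s)\<in>?S. (norm (w s))\<^sup>2 - ?h r s) -
      (\<Sum>(r, s)\<in>?S. ?h r s * ((?t r s)\<^sup>2 / (1 - (?t r s)\<^sup>2)))"
    by (simp add: step case_prod_unfold flip: sum_subtractf) (auto intro!: sum.cong simp: step)
  also have "\<dots> \<le> CARD('m) * (real CARD('m) - 1) * (1 - 1 / scaled_cond A)\<^sup>2 * (norm z)\<^sup>2 -
      CARD('m) * (real CARD('m) - 1) * (coherence_gain A / scaled_cond A) * (norm z)\<^sup>2"
    unfolding w_def
    by (intro diff_mono sum_two_kaczmarz_steps_le[OF std full m] sum_coherence_gain_ge[OF std ind full m])
  finally show ?thesis
    unfolding card_distinct_pairs z_def by (simp only: algebra_simps)
qed

section \<open>Averaging over independent choices\<close>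

lemma (in prob_space) integrable_comp_finite:
  fixes g :: "'c \<Rightarrow> real"
  assumes X: "X \<in> measurable M (count_space C)" and C: "finite C"
  shows "integrable M (\<lambda>\<omega>. g (X \<omega>))"
proof (rule integrable_const_bound[where B = "\<Sum>c\<in>C. \<bar>g c\<bar>"])
  show "AE \<omega> in M. norm (g (X \<omega>)) \<le> (\<Sum>c\<in>C. \<bar>g c\<bar>)"
  proof (rule AE_I2)
    fix \<omega> assume "\<omega> \<in> space M"
    then have "X \<omega> \<in> C"
      using measurable_space[OF X] by simp
    then show "norm (g (X \<omega>)) \<le> (\<Sum>c\<in>C. \<bar>g c\<bar>)"
      using member_le_sum[of "X \<omega>" C "\<lambda>c. \<bar>g c\<bar>"] C by simp
  qed
  show "(\<lambda>\<omega>. g (X \<omega>)) \<in> borel_measurable M"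
    by (rule measurable_compose[OF X]) simp
qed

text \<open>Conditioning on \<open>X\<close> without conditional expectations: as \<open>Y\<close> has finitely many values,
  \<open>f X Y\<close> is the sum of the products of \<open>f X y\<close> with the indicator of \<open>Y = y\<close>, and the expectation of each
  product factors. The variable \<open>Y\<close> is a function of \<open>Z\<close> because \<open>indep_var\<close> relates variables
  with values in the same type.\<close>

lemma (in prob_space) expectation_indep_finite:
  fixes X Z :: "'a \<Rightarrow> 'c" and e :: "'c \<Rightarrow> 'b :: finite" and f :: "'c \<Rightarrow> 'b \<Rightarrow> real"
  assumes indep: "indep_var (count_space C) X N Z"
    and C: "finite C" and e[measurable]: "e \<in> measurable N (count_space UNIV)"
  defines "Y \<equiv> \<lambda>\<omega>. e (Z \<omega>)"
  shows "expectation (\<lambda>\<omega>. f (X \<omega>) (Y \<omega>)) =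
    expectation (\<lambda>\<omega>. \<Sum>y\<in>UNIV. prob (Y -` {y} \<inter> space M) * f (X \<omega>) y)"
proof -
  have X[measurable]: "X \<in> measurable M (count_space C)"
    and Z[measurable]: "Z \<in> measurable M N"
    using indep_var_rv1[OF indep] indep_var_rv2[OF indep] by auto
  have Y[measurable]: "Y \<in> measurable M (count_space UNIV)"
    unfolding Y_def by measurable
  have int_X: "integrable M (\<lambda>\<omega>. f (X \<omega>) y)" for y
    by (rule integrable_comp_finite[OF X C])
  have int_Y: "integrable M (\<lambda>\<omega>. indicator {y} (Y \<omega>) :: real)" for y
    by (rule integrable_const_bound[where B = 1]) (auto simp: indicator_def)
  have ind: "indep_var borel (\<lambda>\<omega>. f (X \<omega>) y) borel (\<lambda>\<omega>. indicator {y} (Y \<omega>) :: real)" for y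
    using indep_var_compose[OF indep, of "\<lambda>c. f c y" borel "\<lambda>z. indicator {y} (e z)" borel]
    by (simp add: comp_def Y_def)
  have prod: "integrable M (\<lambda>\<omega>. f (X \<omega>) y * indicator {y} (Y \<omega>))"
    "expectation (\<lambda>\<omega>. f (X \<omega>) y * indicator {y} (Y \<omega>)) =
      expectation (\<lambda>\<omega>. f (X \<omega>) y) * prob (Y -` {y} \<inter> space M)" for y
  proof -
    show "integrable M (\<lambda>\<omega>. f (X \<omega>) y * indicator {y} (Y \<omega>))"
      by (rule indep_var_integrable[OF ind int_X int_Y])
    have "expectation (\<lambda>\<omega>. indicator {y} (Y \<omega>) :: real) =
        expectation (indicator (Y -` {y} \<inter> space M))"
      by (rule Bochner_Integration.integral_cong) (auto simp: indicator_def)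
    then show "expectation (\<lambda>\<omega>. f (X \<omega>) y * indicator {y} (Y \<omega>)) =
        expectation (\<lambda>\<omega>. f (X \<omega>) y) * prob (Y -` {y} \<inter> space M)"
      by (simp add: indep_var_lebesgue_integral[OF ind int_X int_Y])
  qed
  have "expectation (\<lambda>\<omega>. f (X \<omega>) (Y \<omega>)) =
      expectation (\<lambda>\<omega>. \<Sum>y\<in>UNIV. f (X \<omega>) y * indicator {y} (Y \<omega>))"
    by (simp add: indicator_def if_distrib cong: if_cong)
  also have "\<dots> = (\<Sum>y\<in>UNIV. expectation (\<lambda>\<omega>. f (X \<omega>) y * indicator {y} (Y \<omega>)))"
    by (rule Bochner_Integration.integral_sum[OF prod(1)])
  also have "\<dots> = (\<Sum>y\<in>UNIV. expectation (\<lambda>\<omega>. f (X \<omega>) y) * prob (Y -` {y} \<inter> space M))"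
    by (simp only: prod(2))
  also have "\<dots> = expectation (\<lambda>\<omega>. \<Sum>y\<in>UNIV. prob (Y -` {y} \<inter> space M) * f (X \<omega>) y)"
    by (simp add: int_X mult.commute)
  finally show ?thesis .
qed

lemma prob_iid_uniform_pairs:
  fixes P :: "nat \<Rightarrow> 'w \<Rightarrow> 'm :: finite \<times> 'm"
  assumes M: "prob_space M" and P: "iid_uniform_pairs M P" and "1 \<le> k" and m: "1 < CARD('m)"
  shows "measure M (P k -` {y} \<inter> space M) =
    indicator {(r, s). r \<noteq> s} y / card {(r, s :: 'm). r \<noteq> s}"
proof -
  interpret prob_space M by fact
  let ?S = "{(r, s :: 'm). r \<noteq> s}"
  have rv: "P k \<in> measurable M (count_space UNIV)"
    using P \<open>1 \<le> k\<close> by (auto simp: iid_uniform_pairs_def indep_vars_def)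
  have "real (card ?S) \<noteq> 0"
    using m unfolding card_distinct_pairs by simp
  then have ne: "?S \<noteq> {}"
    by force
  have "measure M (P k -` {y} \<inter> space M) = measure (distr M (count_space UNIV) (P k)) {y}"
    by (simp add: measure_distr[OF rv])
  also have "\<dots> = pmf (pmf_of_set ?S) y"
    using P \<open>1 \<le> k\<close> by (simp add: iid_uniform_pairs_def measure_pmf_single)
  also have "\<dots> = indicator ?S y / card ?S"
    using ne by (simp add: pmf_of_set)
  finally show ?thesis .
qed

lemma two_subspace_iterate_cong:
  assumes "\<And>i. i \<in> {1..k} \<Longrightarrow> p i = q i"
  shows "two_subspace_iterate A b x0 p k = two_subspace_iterate A b x0 q k"
  using assms by (induction k) auto

text \<open>The iterate after \<open>k\<close> steps is a function of the history \<open>H\<close> of the first \<open>k\<close> pairs, which takes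
  finitely many values and is independent of the pair chosen next. Averaging over that pair first
  turns the contraction of the average, valid for every fixed iterate, into one of the expectation.\<close>

lemma expectation_two_subspace_Suc_le:
  fixes A :: "complex ^ 'n ^ 'm" and P :: "nat \<Rightarrow> 'w \<Rightarrow> 'm \<times> 'm"
  assumes M: "prob_space M" and P: "iid_uniform_pairs M P" and m: "1 < CARD('m)"
    and step: "\<And>y. (\<Sum>p\<in>{(r, s). r \<noteq> s}. (norm (x - two_subspace_step A b p y))\<^sup>2) \<le>
      card {(r, s :: 'm). r \<noteq> s} * (\<rho> * (norm (x - y))\<^sup>2)"
  shows "prob_space.expectation M
      (\<lambda>\<omega>. (norm (x - two_subspace_iterate A b x0 (\<lambda>i. P i \<omega>) (Suc k)))\<^sup>2) \<le>
    \<rho> * prob_space.expectation M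
      (\<lambda>\<omega>. (norm (x - two_subspace_iterate A b x0 (\<lambda>i. P i \<omega>) k))\<^sup>2)"
proof -
  interpret prob_space M by fact
  let ?S = "{(r, s :: 'm). r \<noteq> s}"
  define C where "C = (PiE {1..k} (\<lambda>_. UNIV :: ('m \<times> 'm) set))"
  define H where "H = (\<lambda>\<omega>. restrict (\<lambda>i. P i \<omega>) {1..k})"
  define it where "it = (\<lambda>h. two_subspace_iterate A b x0 h k)"
  define f where "f = (\<lambda>h p. (norm (x - two_subspace_step A b p (it h)))\<^sup>2)"
  have finC: "finite C"
    by (simp add: C_def finite_PiE)
  have it: "two_subspace_iterate A b x0 (\<lambda>i. P i \<omega>) k = it (H \<omega>)" for \<omega>
    unfolding it_def by (rule two_subspace_iterate_cong) (simp add: H_def)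
  have indP: "indep_vars (\<lambda>_. count_space UNIV) P {1..}"
    using P by (simp add: iid_uniform_pairs_def)
  have ind: "indep_var (count_space C) H
      (PiM {Suc k} (\<lambda>_. count_space UNIV)) (\<lambda>\<omega>. restrict (\<lambda>i. P i \<omega>) {Suc k})"
    unfolding H_def C_def count_space_PiM_finite[OF finite_atLeastAtMost countableI_type, symmetric]
    by (rule indep_var_restrict[OF indP]) auto
  have int: "integrable M (\<lambda>\<omega>. g (H \<omega>))" for g :: "_ \<Rightarrow> real"
    by (rule integrable_comp_finite[OF indep_var_rv1[OF ind] finC])
  have "expectation (\<lambda>\<omega>. (norm (x - two_subspace_iterate A b x0 (\<lambda>i. P i \<omega>) (Suc k)))\<^sup>2) =
      expectation (\<lambda>\<omega>. f (H \<omega>) (P (Suc k) \<omega>))"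
    by (simp add: f_def it)
  also have "\<dots> = expectation (\<lambda>\<omega>. \<Sum>p\<in>UNIV. prob (P (Suc k) -` {p} \<inter> space M) * f (H \<omega>) p)"
    using expectation_indep_finite[OF ind finC, of "\<lambda>h. h (Suc k)" f]
    by (simp add: measurable_component_singleton)
  also have "\<dots> \<le> expectation (\<lambda>\<omega>. \<rho> * (norm (x - it (H \<omega>)))\<^sup>2)"
  proof (intro integral_mono int)
    fix \<omega>
    have card: "0 < real (card ?S)"
      using m unfolding card_distinct_pairs by simp
    have "(\<Sum>p\<in>UNIV. prob (P (Suc k) -` {p} \<inter> space M) * f (H \<omega>) p) =
        (\<Sum>p\<in>?S. f (H \<omega>) p) / card ?S"
      unfolding sum_divide_distrib
      by (intro sum.mono_neutral_cong_right)
        (auto simp: prob_iid_uniform_pairs[OF M P _ m] indicator_def)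
    also have "\<dots> \<le> \<rho> * (norm (x - it (H \<omega>)))\<^sup>2"
      using step[of "it (H \<omega>)"] card by (simp add: f_def field_simps)
    finally show "(\<Sum>p\<in>UNIV. prob (P (Suc k) -` {p} \<inter> space M) * f (H \<omega>) p) \<le>
        \<rho> * (norm (x - it (H \<omega>)))\<^sup>2" .
  qed
  finally show ?thesis
    by (simp add: it)
qed

section \<open>Linear convergence in expectation\<close>

theorem theorem1p1:
  fixes A :: "complex ^ 'n ^ 'm"
    and b :: "complex ^ 'm"
    and x x0 :: "complex ^ 'n"
    and M :: "'w measure"
    and P :: "nat \<Rightarrow> 'w \<Rightarrow> 'm \<times> 'm"
    and k :: nat
  assumes "CARD('n) < CARD('m)"
    and "rank A = CARD('n)"
    and "standardized A"
    and "rows_pairwise_independent A"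
    and "A *v x = b"
    and "prob_space M"
    and "iid_uniform_pairs M P"
  shows "prob_space.expectation M
           (\<lambda>\<omega>. (norm (x - two_subspace_iterate A b x0 (\<lambda>i. P i \<omega>) k))\<^sup>2)
         \<le> ((1 - 1 / scaled_cond A)\<^sup>2 - coherence_gain A / scaled_cond A) ^ k
             * (norm (x - x0))\<^sup>2"
proof -
  interpret prob_space M by fact
  define \<rho> where "\<rho> = (1 - 1 / scaled_cond A)\<^sup>2 - coherence_gain A / scaled_cond A"
  have m: "1 < CARD('m)"
    using assms(1) zero_less_card_finite[where 'a = 'n] by linarith
  have step: "(\<Sum>p\<in>{(r, s). r \<noteq> s}. (norm (x - two_subspace_step A b p y))\<^sup>2) \<le>
      card {(r, s :: 'm). r \<noteq> s} * (\<rho> * (norm (x - y))\<^sup>2)" for y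
    unfolding \<rho>_def by (rule average_two_subspace_step_error_le) (use assms m in auto)
  \<comment> \<open>If \<open>\<rho>\<close> were negative, a sum of squares would be negative for an error of norm one.\<close>
  have "0 \<le> \<rho>"
  proof -
    obtain e :: "complex ^ 'n" where e: "norm e = 1"
      using vector_choose_size[of 1] by auto
    have pos: "0 < real (card {(r, s :: 'm). r \<noteq> s})"
      using m unfolding card_distinct_pairs by simp
    have "0 \<le> card {(r, s :: 'm). r \<noteq> s} * \<rho>"
      using order_trans[OF sum_nonneg step[of "x - e"]] e by simp
    then show ?thesis
      using mult_le_cancel_left_pos[OF pos, of 0 \<rho>] by (simp only: mult_zero_right)
  qed
  have "expectation (\<lambda>\<omega>. (norm (x - two_subspace_iterate A b x0 (\<lambda>i. P i \<omega>) k))\<^sup>2)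
      \<le> \<rho> ^ k * (norm (x - x0))\<^sup>2"
  proof (induction k)
    case 0
    show ?case by (simp add: prob_space)
  next
    case (Suc k)
    show ?case
      using order_trans[OF expectation_two_subspace_Suc_le[OF assms(6,7) m step]
          mult_left_mono[OF Suc \<open>0 \<le> \<rho>\<close>]]
      by (simp add: mult.assoc)
  qed
  then show ?thesis
    by (simp add: \<rho>_def)
qed

end
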